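(* Fix any $p_0\in[1,\infty]$. For any compact $p_0$-metric spaces $X,Y$, the function $p\mapsto d_{\mathrm{GH}}^{(p)}(X,Y)$ is continuous on $[1,p_0]$ (where for $p_0=\infty$ the interval $[1,\infty]$ carries its usual extended-real topology).
   Context: All metric spaces are nonempty. For $a,b\ge 0$: $a\boxplus_p b=(a^p+b^p)^{1/p}$ for $p\in[1,\infty)$ and $a\boxplus_\infty b=\max(a,b)$. A $p$-metric space is a metric space satisfying $d(x,x'')\le d(x,x')\boxplus_p d(x',x'')$ for all points (for $p=\infty$: an ultrametric space). For $a,b\ge0$: $\Lambda_p(a,b)=|a^p-b^p|^{1/p}$ for $p\in[1,\infty)$; $\Lambda_\infty(a,b)=\max(a,b)$ if $a\ne b$ and $0$ if $a=b$. For metric spaces $X,Y$ and $p\in[1,\infty]$, $$d_{\mathrm{GH}}^{(p)}(X,Y)=2^{-\frac1p}\inf_R\ \sup_{(x,y),(x',y')\in R}\Lambda_p(d_X(x,x'),d_Y(y,y')),$$ with $R$ ranging over all correspondences between $X$ and $Y$ (subsets of $X\times Y$ projecting onto both factors) and the convention $\frac1\infty=0$. *)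

theory Defs
  imports "HOL-Analysis.Analysis"
begin

text \<open>The exponent \<open>p\<close> is an extended real; all definitions are meant for \<open>1 \<le> p \<le> \<infinity>\<close>.\<close>

definition boxplus :: "ereal \<Rightarrow> real \<Rightarrow> real \<Rightarrow> real" where
  "boxplus p a b =
     (if p = \<infinity> then max a b
      else (a powr real_of_ereal p + b powr real_of_ereal p) powr (1 / real_of_ereal p))"

definition Lambda :: "ereal \<Rightarrow> real \<Rightarrow> real \<Rightarrow> real" where
  "Lambda p a b =
     (if p = \<infinity> then (if a = b then 0 else max a b)
      else \<bar>a powr real_of_ereal p - b powr real_of_ereal p\<bar> powr (1 / real_of_ereal p))"

definition p_metric_space :: "ereal \<Rightarrow> 'a set \<Rightarrow> ('a \<Rightarrow> 'a \<Rightarrow> real) \<Rightarrow> bool" where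
  "p_metric_space p X d \<longleftrightarrow>
     Metric_space X d \<and> X \<noteq> {} \<and>
     (\<forall>x\<in>X. \<forall>x'\<in>X. \<forall>x''\<in>X. d x x'' \<le> boxplus p (d x x') (d x' x''))"

definition correspondences :: "'a set \<Rightarrow> 'b set \<Rightarrow> ('a \<times> 'b) set set" where
  "correspondences X Y = {R. R \<subseteq> X \<times> Y \<and> fst ` R = X \<and> snd ` R = Y}"

text \<open>The distance takes values in \<open>[0, \<infinity>]\<close>, so that supremum and infimum make sense for
  arbitrary, possibly unbounded, metric spaces. In the prefactor, \<open>1 / \<infinity> = 0\<close> holds in
  \<^typ>\<open>ereal\<close>.\<close>

definition GH_dist ::
    "ereal \<Rightarrow> 'a set \<Rightarrow> ('a \<Rightarrow> 'a \<Rightarrow> real) \<Rightarrow> 'b set \<Rightarrow> ('b \<Rightarrow> 'b \<Rightarrow> real) \<Rightarrow> ennreal" where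
  "GH_dist p X dX Y dY =
     ennreal (2 powr (- real_of_ereal (1 / p))) *
     (INF R \<in> correspondences X Y.
        SUP ((x, y), (x', y')) \<in> R \<times> R. ennreal (Lambda p (dX x x') (dY y y')))"

text \<open>For compact spaces the distance is finite, so that continuity in \<^typ>\<open>ennreal\<close> is the
  same as continuity of a real-valued function.\<close>

lemma Lambda_le:
  assumes "1 \<le> p" "0 \<le> a" "a \<le> C" "0 \<le> b" "b \<le> C"
  shows "Lambda p a b \<le> C"
proof (cases "p = \<infinity>")
  case True
  then show ?thesis using assms by (auto simp: Lambda_def)
next
  case False
  then obtain q where q: "p = ereal q" "1 \<le> q"
    using assms(1) by (cases p) auto
  have "a powr q \<le> C powr q" "b powr q \<le> C powr q"
    using assms q by (auto intro!: powr_mono2)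
  then have "\<bar>a powr q - b powr q\<bar> \<le> C powr q"
    using powr_ge_zero[of a q] powr_ge_zero[of b q] by linarith
  then have "\<bar>a powr q - b powr q\<bar> powr (1 / q) \<le> (C powr q) powr (1 / q)"
    using q by (intro powr_mono2) auto
  also have "\<dots> = C" using assms q by (simp add: powr_powr)
  finally show ?thesis using q by (simp add: Lambda_def)
qed

lemma compact_metric_bounded:
  assumes "Metric_space X d" "compact_space (Metric_space.mtopology X d)"
  shows "\<exists>C. \<forall>x\<in>X. \<forall>y\<in>X. d x y \<le> C"
proof -
  interpret Metric_space X d by fact
  have "compactin mtopology X"
    using assms(2) by (simp add: compact_space_def)
  then have "mbounded X" by (rule compactin_imp_mbounded)
  then show ?thesis by (auto simp: mbounded_alt)
qed

lemma GH_dist_finite: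
  assumes "1 \<le> p"
    and X: "Metric_space X dX" "compact_space (Metric_space.mtopology X dX)" "X \<noteq> {}"
    and Y: "Metric_space Y dY" "compact_space (Metric_space.mtopology Y dY)" "Y \<noteq> {}"
  shows "GH_dist p X dX Y dY < \<infinity>"
proof -
  obtain C D where C: "\<forall>x\<in>X. \<forall>y\<in>X. dX x y \<le> C" and D: "\<forall>x\<in>Y. \<forall>y\<in>Y. dY x y \<le> D"
    using compact_metric_bounded[OF X(1,2)] compact_metric_bounded[OF Y(1,2)] by blast
  have R: "X \<times> Y \<in> correspondences X Y"
    using X(3) Y(3) by (auto simp: correspondences_def)
  have "(INF R \<in> correspondences X Y.
        SUP ((x, y), (x', y')) \<in> R \<times> R. ennreal (Lambda p (dX x x') (dY y y')))
      \<le> (SUP ((x, y), (x', y')) \<in> (X \<times> Y) \<times> (X \<times> Y). ennreal (Lambda p (dX x x') (dY y y')))"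
    using R by (rule INF_lower)
  also have "\<dots> \<le> ennreal (max C D)"
  proof (rule SUP_least, clarify)
    fix x y x' y' assume h: "x \<in> X" "y \<in> Y" "x' \<in> X" "y' \<in> Y"
    have "dX x x' \<le> C" "dY y y' \<le> D" using C D h by auto
    then show "ennreal (Lambda p (dX x x') (dY y y')) \<le> ennreal (max C D)"
      using assms(1) Metric_space.nonneg[OF X(1)] Metric_space.nonneg[OF Y(1)]
      by (intro ennreal_leI Lambda_le) auto
  qed
  also have "\<dots> < \<infinity>" by simp
  finally show ?thesis unfolding GH_dist_def
    by (simp add: ennreal_mult_less_top)
qed

end

theory Submission
  imports Defs
begin

text \<open>
  Correspondences see \<open>p\<close> only through \<open>\<Lambda>\<^sub>p\<close> on pairs of distances, so it suffices that
  \<open>\<Lambda>\<^sub>p \<longlongrightarrow> \<Lambda>\<^sub>q\<close> uniformly on the product of the two distance sets. For finite \<open>q\<close> this is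
  uniform continuity on a compact box. For \<open>q = \<infinity>\<close> it fails on a box, since \<open>\<Lambda>\<^sub>\<infinity>\<close> jumps at the
  diagonal, but both spaces are then compact ultrametric: only finitely many distances exceed any
  \<open>\<epsilon> > 0\<close>, so above \<open>\<epsilon>\<close> the ratio of two distinct distances is bounded away from \<open>1\<close>.
\<close>

section \<open>Pointwise estimates for \<open>Lambda\<close>\<close>

lemma Lambda_commute: "Lambda p a b = Lambda p b a"
  by (auto simp: Lambda_def max.commute abs_minus_commute)

lemma Lambda_nonneg:
  assumes "0 \<le> a" "0 \<le> b"
  shows "0 \<le> Lambda p a b"
  using assms by (auto simp: Lambda_def)

lemma Lambda_le_Lambda_infinity:
  assumes "1 \<le> p" "0 \<le> a" "0 \<le> b"
  shows "Lambda p a b \<le> Lambda \<infinity> a b"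
proof (cases "a = b")
  case True
  then show ?thesis by (simp add: Lambda_def)
next
  case False
  then have "Lambda \<infinity> a b = max a b" by (simp add: Lambda_def)
  with Lambda_le[of p a "max a b" b] assms show ?thesis by simp
qed

text \<open>Since \<open>q\<close> is at least 1 and \<open>r < 1\<close>, \<open>r powr q\<close>
  is at most \<open>r\<close>; hence \<open>a powr q - b powr q\<close> is at least
  \<open>a powr q * (1 - r)\<close>. After the \<open>q\<close>-th root the factor tends to 1 as
  \<open>q\<close> grows, at a rate depending only on \<open>r\<close>.\<close>

lemma Lambda_ge_of_ratio_le:
  assumes "1 \<le> q" "0 \<le> b" "b \<le> r * a" "0 \<le> a" "0 < r" "r < 1"
  shows "a * (1 - r) powr (1 / q) \<le> Lambda (ereal q) a b"
proof -
  have "r powr q \<le> r powr 1"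
    using assms by (intro powr_mono') auto
  then have "r powr q \<le> r" using assms by simp
  then have "a powr q * (1 - r) \<le> a powr q * (1 - r powr q)"
    by (intro mult_left_mono) auto
  also have "\<dots> = a powr q - (r * a) powr q"
    using assms by (simp add: powr_mult algebra_simps)
  also have "\<dots> \<le> a powr q - b powr q"
    using assms powr_mono2[of q b "r * a"] by simp
  finally have "a powr q * (1 - r) \<le> \<bar>a powr q - b powr q\<bar>" by linarith
  then have "(a powr q * (1 - r)) powr (1 / q) \<le> \<bar>a powr q - b powr q\<bar> powr (1 / q)"
    using assms by (intro powr_mono2) auto
  moreover have "(a powr q * (1 - r)) powr (1 / q) = a * (1 - r) powr (1 / q)"
    using assms by (simp add: powr_mult powr_powr)
  ultimately show ?thesis by (simp add: Lambda_def)
qed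

section \<open>Uniform convergence of \<open>Lambda\<close> at finite and infinite exponents\<close>

lemma uniform_limit_Lambda_finite:
  assumes "1 \<le> r" "D \<subseteq> {0..C} \<times> {0..C}"
  shows "uniform_limit D (\<lambda>p (a, b). Lambda p a b) (\<lambda>(a, b). Lambda (ereal r) a b)
           (at (ereal r) within {1..})"
proof (rule uniform_limitI)
  fix e :: real assume "e > 0"
  let ?f = "\<lambda>(s::real, a::real, b::real). \<bar>a powr s - b powr s\<bar> powr (1 / s)"
  let ?K = "{1..r + 1} \<times> {0..C} \<times> {0..C}"
  \<comment> \<open>The bases may vanish, even on the whole diagonal, but \<open>powr\<close> is
    still jointly continuous there because the exponents \<open>s\<close> and \<open>1 / s\<close>
    stay positive on \<open>?K\<close>.\<close>
  have "continuous_on ?K ?f"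
    unfolding split_beta
    by (intro continuous_on_powr' continuous_intros) auto
  then have "uniformly_continuous_on ?K ?f"
    by (intro compact_uniformly_continuous compact_Times) auto
  then obtain d where d: "d > 0"
    "\<And>x x'. x \<in> ?K \<Longrightarrow> x' \<in> ?K \<Longrightarrow> dist x' x < d \<Longrightarrow> dist (?f x') (?f x) < e"
    using \<open>e > 0\<close> by (rule uniformly_continuous_onE) blast
  \<comment> \<open>The cap 1 keeps nearby exponents below \<open>r + 1\<close>, hence inside
    \<open>?K\<close>.\<close>
  let ?\<delta> = "min d 1"
  have "\<forall>\<^sub>F p in at (ereal r) within {1..}.
          p \<in> {ereal (r - ?\<delta>)<..<ereal (r + ?\<delta>)} \<and> p \<in> {1..}"
    unfolding eventually_at_topological using d(1)
    by (intro exI[of _ "{ereal (r - ?\<delta>)<..<ereal (r + ?\<delta>)}"]) auto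
  then show "\<forall>\<^sub>F p in at (ereal r) within {1..}. \<forall>x\<in>D.
      dist (case x of (a, b) \<Rightarrow> Lambda p a b) (case x of (a, b) \<Rightarrow> Lambda (ereal r) a b) < e"
  proof (rule eventually_mono, intro ballI)
    fix p :: ereal and x
    assume p: "p \<in> {ereal (r - ?\<delta>)<..<ereal (r + ?\<delta>)} \<and> p \<in> {1..}" and "x \<in> D"
    obtain a b where x: "x = (a, b)" by fastforce
    obtain s where s: "p = ereal s" using p by (cases p) auto
    have s_bounds: "1 \<le> s" "\<bar>s - r\<bar> < ?\<delta>" using p s by auto
    have "dist (?f (s, a, b)) (?f (r, a, b)) < e"
      using assms s_bounds \<open>x \<in> D\<close> x
      by (intro d(2)) (auto simp: dist_prod_def dist_real_def)
    then show "dist (case x of (a, b) \<Rightarrow> Lambda p a b)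
                 (case x of (a, b) \<Rightarrow> Lambda (ereal r) a b) < e"
      using x s by (simp add: Lambda_def)
  qed
qed

text \<open>If \<open>b\<close> is at least \<open>e / 2\<close>, then \<open>b / a\<close> is one
  of finitely many quotients, so those below 1 have a maximum; if \<open>b < e / 2\<close>, then
  \<open>b\<close> is at most \<open>a / 2\<close>.\<close>

lemma ratio_bound_of_finite_above:
  fixes S :: "real set"
  assumes "e > 0" "finite {s \<in> S. e / 2 \<le> s}"
  obtains r where "0 < r" "r < 1"
    "\<And>a b. a \<in> S \<Longrightarrow> b \<in> S \<Longrightarrow> e \<le> a \<Longrightarrow> b < a \<Longrightarrow> b \<le> r * a"
proof -
  let ?S = "{s \<in> S. e / 2 \<le> s}"
  \<comment> \<open>Adjoining \<open>1 / 2\<close> makes the set nonempty, gives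
    \<open>0 < r\<close> and covers the case \<open>b < e / 2\<close>.\<close>
  let ?T = "{t \<in> (\<lambda>(a, b). b / a) ` (?S \<times> ?S). t < 1} \<union> {1 / 2}"
  define r where "r = Max ?T"
  have fin: "finite ?T" using assms(2) by auto
  have "r \<in> ?T" unfolding r_def by (rule Max_in) (use fin in auto)
  then have "r < 1" by auto
  have max: "t \<le> r" if "t \<in> ?T" for t
    unfolding r_def using fin that by (rule Max_ge)
  have half: "1 / 2 \<le> r" by (rule max) auto
  have "b \<le> r * a" if ab: "a \<in> S" "b \<in> S" "e \<le> a" "b < a" for a b
  proof (cases "e / 2 \<le> b")
    case True
    have "(a, b) \<in> ?S \<times> ?S" using ab True assms(1) by auto
    then have "b / a \<in> (\<lambda>(a, b). b / a) ` (?S \<times> ?S)" by force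
    then have "b / a \<in> ?T" using ab assms(1) by auto
    then have "b / a \<le> r" by (rule max)
    then show ?thesis using ab assms(1) by (simp add: divide_le_eq)
  next
    case False
    then have "b \<le> (1 / 2) * a" using ab by simp
    also have "\<dots> \<le> r * a" using half ab assms(1) by (intro mult_right_mono) auto
    finally show ?thesis .
  qed
  with half \<open>r < 1\<close> show thesis by (intro that[of r]) auto
qed

lemma uniform_limit_Lambda_infinity:
  assumes bounded: "S \<subseteq> {0..C}" and fin: "\<And>e. e > 0 \<Longrightarrow> finite {s \<in> S. e \<le> s}"
  shows "uniform_limit (S \<times> S) (\<lambda>p (a, b). Lambda p a b) (\<lambda>(a, b). Lambda \<infinity> a b)
           (at \<infinity> within {1..})"
proof (rule uniform_limitI)
  fix e :: real assume e: "e > 0"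
  obtain r where r: "0 < r" "r < 1"
    "\<And>a b. a \<in> S \<Longrightarrow> b \<in> S \<Longrightarrow> e \<le> a \<Longrightarrow> b < a \<Longrightarrow> b \<le> r * a"
    using ratio_bound_of_finite_above[OF e, of S] fin[of "e / 2"] e by auto
  \<comment> \<open>This is the largest gap the ratio bound allows for distances up to
    \<open>C\<close>; the limit vanishes because \<open>1 - r\<close> is positive.\<close>
  have "((\<lambda>q::real. C * (1 - (1 - r) powr (1 / q))) \<longlongrightarrow> C * (1 - (1 - r) powr 0)) at_top"
    using r(2) by (intro tendsto_intros tendsto_divide_0[OF tendsto_const]
        filterlim_at_top_imp_at_infinity filterlim_ident) auto
  then have "((\<lambda>q::real. C * (1 - (1 - r) powr (1 / q))) \<longlongrightarrow> 0) at_top"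
    using r(2) by simp
  then have "\<forall>\<^sub>F q::real in at_top. C * (1 - (1 - r) powr (1 / q)) < e"
    using e by (rule order_tendstoD(2))
  then obtain N where N: "\<And>q. q \<ge> N \<Longrightarrow> C * (1 - (1 - r) powr (1 / q)) < e"
    unfolding eventually_at_top_linorder by auto
  have ordered: "Lambda \<infinity> a b - Lambda (ereal q) a b < e"
    if "1 \<le> q" "N \<le> q" "a \<in> S" "b \<in> S" "b \<le> a" for a b q
  \<comment> \<open>On the diagonal both values are 0; for \<open>a < e\<close> the value at
    infinity is itself below \<open>e\<close>. Only the remaining pairs need the ratio
    bound.\<close>
  proof (cases "a = b \<or> a < e")
    case True
    moreover have "0 \<le> Lambda (ereal q) a b"
      using that bounded by (intro Lambda_nonneg) auto
    ultimately show ?thesis using that e by (auto simp: Lambda_def[of \<infinity>])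
  next
    case False
    have a: "0 \<le> a" "a \<le> C" "0 \<le> b" using that bounded by auto
    have "a * (1 - r) powr (1 / q) \<le> Lambda (ereal q) a b"
      using False that a r by (intro Lambda_ge_of_ratio_le) auto
    moreover have "Lambda \<infinity> a b = a" using False that by (auto simp: Lambda_def)
    moreover have "a * (1 - (1 - r) powr (1 / q)) \<le> C * (1 - (1 - r) powr (1 / q))"
      using a r that by (intro mult_right_mono) (auto intro: powr_le1)
    ultimately show ?thesis using N[of q] that by (simp add: algebra_simps)
  qed
  \<comment> \<open>The filter \<open>at\<close> is punctured, so only real exponents have to be
    compared with infinity.\<close>
  have "\<forall>\<^sub>F p in at \<infinity> within {1..}. p \<in> {ereal N<..} \<and> p \<in> {1..} \<and> p \<noteq> \<infinity>"
    unfolding eventually_at_topological by (intro exI[of _ "{ereal N<..}"]) auto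
  then show "\<forall>\<^sub>F p in at \<infinity> within {1..}. \<forall>x\<in>S \<times> S.
      dist (case x of (a, b) \<Rightarrow> Lambda p a b) (case x of (a, b) \<Rightarrow> Lambda \<infinity> a b) < e"
  proof (rule eventually_mono, intro ballI)
    fix p :: ereal and x
    assume p: "p \<in> {ereal N<..} \<and> p \<in> {1..} \<and> p \<noteq> \<infinity>" and "x \<in> S \<times> S"
    then obtain a b where x: "x = (a, b)" "a \<in> S" "b \<in> S" by auto
    obtain q where q: "p = ereal q" "1 \<le> q" "N \<le> q" using p by (cases p) auto
    have "Lambda \<infinity> a b - Lambda p a b < e"
      using ordered[of q a b] ordered[of q b a] q x
      by (cases "b \<le> a") (auto simp: Lambda_commute[of _ a b])
    moreover have "Lambda p a b \<le> Lambda \<infinity> a b"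
      using p x bounded by (intro Lambda_le_Lambda_infinity) auto
    ultimately show "dist (case x of (a, b) \<Rightarrow> Lambda p a b)
                       (case x of (a, b) \<Rightarrow> Lambda \<infinity> a b) < e"
      using x by (simp add: dist_real_def)
  qed
qed

text \<open>In an ultrametric space, moving both endpoints by less than \<open>e\<close> leaves a
  distance of at least \<open>e\<close> unchanged. All such distances therefore occur between points
  of a finite \<open>e\<close>-net.\<close>

lemma finite_ultrametric_distances_above:
  assumes X: "p_metric_space \<infinity> X d" and compact: "compact_space (Metric_space.mtopology X d)"
    and "e > 0"
  shows "finite {s \<in> (\<lambda>(x, y). d x y) ` (X \<times> X). e \<le> s}"
proof -
  interpret Metric_space X d using X by (simp add: p_metric_space_def)
  have ultra: "d x z \<le> max (d x y) (d y z)" if "x \<in> X" "y \<in> X" "z \<in> X" for x y z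
    using X that by (auto simp: p_metric_space_def boxplus_def)
  have "mtotally_bounded X"
    using compact by (simp add: compact_space_eq_mcomplete_mtotally_bounded)
  then have "\<exists>K. finite K \<and> K \<subseteq> X \<and> X \<subseteq> (\<Union>x\<in>K. mball x e)"
    using \<open>e > 0\<close> by (simp add: mtotally_bounded_def)
  then obtain K where K: "finite K" "K \<subseteq> X" "X \<subseteq> (\<Union>x\<in>K. mball x e)"
    by (elim exE conjE)
  have "{s \<in> (\<lambda>(x, y). d x y) ` (X \<times> X). e \<le> s} \<subseteq> (\<lambda>(x, y). d x y) ` (K \<times> K)"
  proof clarify
    fix x y assume xy: "x \<in> X" "y \<in> X" "e \<le> d x y"
    obtain k l where "k \<in> K" "x \<in> mball k e" and "l \<in> K" "y \<in> mball l e"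
      using subsetD[OF K(3) xy(1)] subsetD[OF K(3) xy(2)] by blast
    then have kl: "k \<in> K" "l \<in> K" "d k x < e" "d l y < e" by auto
    have kl': "k \<in> X" "l \<in> X" using kl K(2) by auto
    have "d x y \<le> d k l"
      using ultra[of x k y] ultra[of k l y] kl kl' xy commute[of x k] by auto
    moreover have "d k l \<le> d x y"
      using ultra[of k x l] ultra[of x y l] kl kl' xy commute[of y l] by auto
    ultimately have "d x y = d k l" by simp
    then show "d x y \<in> (\<lambda>(x, y). d x y) ` (K \<times> K)" using kl by force
  qed
  then show ?thesis using K(1) finite_subset by blast
qed

section \<open>From \<open>Lambda\<close> to the infimum over correspondences\<close>

definition GH_infimum ::
    "ereal \<Rightarrow> 'a set \<Rightarrow> ('a \<Rightarrow> 'a \<Rightarrow> real) \<Rightarrow> 'b set \<Rightarrow> ('b \<Rightarrow> 'b \<Rightarrow> real) \<Rightarrow> ennreal" where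
  "GH_infimum p X dX Y dY =
     (INF R \<in> correspondences X Y.
        SUP ((x, y), (x', y')) \<in> R \<times> R. ennreal (Lambda p (dX x x') (dY y y')))"

lemma GH_dist_eq:
  "GH_dist p X dX Y dY = ennreal (2 powr (- real_of_ereal (1 / p))) * GH_infimum p X dX Y dY"
  by (simp add: GH_dist_def GH_infimum_def)

lemma GH_infimum_le_add:
  assumes "0 \<le> e"
    and "\<And>x x' y y'. x \<in> X \<Longrightarrow> x' \<in> X \<Longrightarrow> y \<in> Y \<Longrightarrow> y' \<in> Y \<Longrightarrow>
           Lambda p (dX x x') (dY y y') \<le> Lambda q (dX x x') (dY y y') + e"
  shows "GH_infimum p X dX Y dY \<le> GH_infimum q X dX Y dY + ennreal e"
proof -
  let ?dis = "\<lambda>p R. SUP ((x, y), (x', y')) \<in> R \<times> R. ennreal (Lambda p (dX x x') (dY y y'))"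
  \<comment> \<open>With \<open>e\<close> moved to the left by truncated subtraction, the right side
    is a bare term of the infimum for \<open>q\<close>, as \<open>INF_greatest\<close>
    requires.\<close>
  have "GH_infimum p X dX Y dY - ennreal e \<le> ?dis q R" if R: "R \<in> correspondences X Y" for R
  proof -
    have "?dis p R \<le> ?dis q R + ennreal e"
    proof (rule SUP_least, clarify)
      fix x y x' y' assume xy: "(x, y) \<in> R" "(x', y') \<in> R"
      then have "x \<in> X" "x' \<in> X" "y \<in> Y" "y' \<in> Y" using R by (auto simp: correspondences_def)
      then have "ennreal (Lambda p (dX x x') (dY y y'))
          \<le> ennreal (Lambda q (dX x x') (dY y y') + e)"
        by (intro ennreal_leI assms(2))
      also have "\<dots> \<le> ennreal (Lambda q (dX x x') (dY y y')) + ennreal e"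
        \<comment> \<open>\<open>ennreal\<close> sends negative reals to 0, and for arbitrary
          \<open>dX\<close>, \<open>dY\<close> the value of \<open>Lambda\<close> at infinity can be
          negative.\<close>
        using assms(1) by (cases "0 \<le> Lambda q (dX x x') (dY y y')")
          (auto simp: ennreal_plus ennreal_neg intro!: ennreal_leI)
      also have "\<dots> \<le> ?dis q R + ennreal e"
        using xy by (intro add_right_mono SUP_upper2[of "((x, y), (x', y'))"]) auto
      finally show "ennreal (Lambda p (dX x x') (dY y y')) \<le> ?dis q R + ennreal e" .
    qed
    moreover have "GH_infimum p X dX Y dY \<le> ?dis p R"
      unfolding GH_infimum_def using R by (rule INF_lower)
    ultimately show ?thesis
      by (auto simp: ennreal_minus_le_iff add.commute intro: order_trans)
  qed
  then have "GH_infimum p X dX Y dY - ennreal e \<le> GH_infimum q X dX Y dY"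
    unfolding GH_infimum_def[of q] by (intro INF_greatest)
  then show ?thesis by (simp add: ennreal_minus_le_iff add.commute)
qed

text \<open>Uniform closeness of \<open>Lambda\<close> bounds the two infima by each other up to
  \<open>e\<close>. Finiteness at \<open>q\<close> then spreads to nearby exponents, and convergence
  can be checked on real values.\<close>

lemma GH_infimum_tendsto:
  assumes unif: "uniform_limit ((\<lambda>(x, x'). dX x x') ` (X \<times> X) \<times> (\<lambda>(y, y'). dY y y') ` (Y \<times> Y))
      (\<lambda>p (a, b). Lambda p a b) (\<lambda>(a, b). Lambda q a b) F"
    and finite_q: "GH_infimum q X dX Y dY < top"
  shows "((\<lambda>p. GH_infimum p X dX Y dY) \<longlongrightarrow> GH_infimum q X dX Y dY) F"
proof -
  let ?h = "\<lambda>p. enn2real (GH_infimum p X dX Y dY)"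
  have close: "\<forall>\<^sub>F p in F. GH_infimum p X dX Y dY \<le> GH_infimum q X dX Y dY + ennreal e \<and>
      GH_infimum q X dX Y dY \<le> GH_infimum p X dX Y dY + ennreal e" if "e > 0" for e :: real
    using uniform_limitD[OF unif that]
  proof (rule eventually_mono)
    fix p
    assume *: "\<forall>x\<in>(\<lambda>(x, x'). dX x x') ` (X \<times> X) \<times> (\<lambda>(y, y'). dY y y') ` (Y \<times> Y).
      dist (case x of (a, b) \<Rightarrow> Lambda p a b) (case x of (a, b) \<Rightarrow> Lambda q a b) < e"
    have "dist (Lambda p (dX x x') (dY y y')) (Lambda q (dX x x') (dY y y')) < e"
      if "x \<in> X" "x' \<in> X" "y \<in> Y" "y' \<in> Y" for x x' y y'
      using that bspec[OF *, of "(dX x x', dY y y')"] by force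
    then show "GH_infimum p X dX Y dY \<le> GH_infimum q X dX Y dY + ennreal e \<and>
        GH_infimum q X dX Y dY \<le> GH_infimum p X dX Y dY + ennreal e"
      using \<open>e > 0\<close> by (intro conjI GH_infimum_le_add) (force simp: dist_real_def)+
  qed
  have finite_p: "\<forall>\<^sub>F p in F. GH_infimum p X dX Y dY < top"
    using close[of 1] finite_q by (auto elim!: eventually_mono intro: le_less_trans)
  have "(?h \<longlongrightarrow> ?h q) F"
  proof (rule tendstoI)
    fix e :: real assume e: "e > 0"
    have "\<forall>\<^sub>F p in F. dist (?h p) (?h q) \<le> e / 2"
      using close[of "e / 2", OF half_gt_zero[OF e]] finite_p
    proof eventually_elim
      case (elim p)
      obtain u where u: "0 \<le> u" "GH_infimum p X dX Y dY = ennreal u"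
        using elim by (cases "GH_infimum p X dX Y dY" rule: ennreal_cases) auto
      obtain v where v: "0 \<le> v" "GH_infimum q X dX Y dY = ennreal v"
        using finite_q by (cases "GH_infimum q X dX Y dY" rule: ennreal_cases) auto
      have "u \<le> v + e / 2" "v \<le> u + e / 2"
        using elim u v e by (auto simp flip: ennreal_plus)
      then have "\<bar>u - v\<bar> \<le> e / 2" by linarith
      with u v show ?case by (simp add: dist_real_def)
    qed
    then show "\<forall>\<^sub>F p in F. dist (?h p) (?h q) < e"
      using e by (auto elim!: eventually_mono)
  qed
  then have "((\<lambda>p. ennreal (?h p)) \<longlongrightarrow> ennreal (?h q)) F" by (rule tendsto_ennrealI)
  moreover have "\<forall>\<^sub>F p in F. ennreal (?h p) = GH_infimum p X dX Y dY"
    using finite_p by eventually_elim simp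
  ultimately show ?thesis using finite_q by (simp add: tendsto_cong)
qed

text \<open>Inversion is continuous on \<open>ereal\<close> from 1 up to and including infinity,
  where its value is 0, so the endpoint needs no separate treatment.\<close>

lemma tendsto_GH_prefactor:
  fixes q :: ereal
  assumes "1 \<le> q"
  shows "((\<lambda>p. ennreal (2 powr (- real_of_ereal (1 / p)))) \<longlongrightarrow>
           ennreal (2 powr (- real_of_ereal (1 / q)))) (at q within {1..})"
proof -
  have "continuous_on {1..} (inverse :: ereal \<Rightarrow> ereal)"
    by (rule continuous_on_subset[OF continuous_on_inverse_ereal]) (auto intro: order_trans[of 0 1])
  then have "((\<lambda>p. inverse p) \<longlongrightarrow> inverse q) (at q within {1..})"
    using assms by (auto simp: continuous_on_def)
  moreover have "inverse q = ereal (real_of_ereal (inverse q))"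
    using assms by (cases q) auto
  ultimately have "((\<lambda>p. real_of_ereal (inverse p)) \<longlongrightarrow> real_of_ereal (inverse q))
      (at q within {1..})"
    by (intro lim_real_of_ereal) simp
  then show ?thesis
    by (intro tendsto_ennrealI tendsto_powr tendsto_minus tendsto_const)
      (simp_all add: divide_ereal_def)
qed

theorem proposition4p12:
  fixes p\<^sub>0 :: ereal
    and X :: "'a set" and dX :: "'a \<Rightarrow> 'a \<Rightarrow> real"
    and Y :: "'b set" and dY :: "'b \<Rightarrow> 'b \<Rightarrow> real"
  assumes "1 \<le> p\<^sub>0"
    and "p_metric_space p\<^sub>0 X dX" and "compact_space (Metric_space.mtopology X dX)"
    and "p_metric_space p\<^sub>0 Y dY" and "compact_space (Metric_space.mtopology Y dY)"
  shows "continuous_on {1..p\<^sub>0} (\<lambda>p. GH_dist p X dX Y dY)"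
  unfolding continuous_on_def
proof
  fix q assume q: "q \<in> {1..p\<^sub>0}"
  let ?DX = "(\<lambda>(x, x'). dX x x') ` (X \<times> X)" and ?DY = "(\<lambda>(y, y'). dY y y') ` (Y \<times> Y)"
  have X: "Metric_space X dX" "X \<noteq> {}" and Y: "Metric_space Y dY" "Y \<noteq> {}"
    using assms(2,4) by (auto simp: p_metric_space_def)
  obtain A B where A: "\<forall>x\<in>X. \<forall>x'\<in>X. dX x x' \<le> A" and B: "\<forall>y\<in>Y. \<forall>y'\<in>Y. dY y y' \<le> B"
    using compact_metric_bounded[OF X(1) assms(3)] compact_metric_bounded[OF Y(1) assms(5)]
    by blast
  have bounded: "?DX \<union> ?DY \<subseteq> {0..max A B}"
    using A B Metric_space.nonneg[OF X(1)] Metric_space.nonneg[OF Y(1)]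
    by (auto simp: le_max_iff_disj)
  have unif: "uniform_limit (?DX \<times> ?DY) (\<lambda>p (a, b). Lambda p a b) (\<lambda>(a, b). Lambda q a b)
      (at q within {1..})"
  proof (cases "q = \<infinity>")
    case True
    then have "p\<^sub>0 = \<infinity>" using q by simp
    \<comment> \<open>Both spaces are now ultrametric. The union is taken because
      \<open>Lambda\<close> compares a distance in \<open>X\<close> with one in \<open>Y\<close>, so
      the ratio bound must cover mixed pairs.\<close>
    then have "finite {s \<in> ?DX \<union> ?DY. e \<le> s}" if "e > 0" for e
      using finite_ultrametric_distances_above[of X dX e]
        finite_ultrametric_distances_above[of Y dY e] assms that
      by (simp add: Collect_disj_eq conj_disj_distribR)
    from uniform_limit_Lambda_infinity[OF bounded this] show ?thesis
      unfolding True by (rule uniform_limit_on_subset) auto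
  next
    case False
    then obtain r where "q = ereal r" "1 \<le> r" using q by (cases q) auto
    with bounded show ?thesis by (auto intro!: uniform_limit_Lambda_finite)
  qed
  have "GH_dist q X dX Y dY < \<infinity>"
    using q by (intro GH_dist_finite X Y assms) auto
  \<comment> \<open>The prefactor is positive, so a finite product forces a finite infimum.\<close>
  then have "GH_infimum q X dX Y dY < top"
    by (auto simp: GH_dist_eq ennreal_mult_less_top)
  with unif have "((\<lambda>p. GH_infimum p X dX Y dY) \<longlongrightarrow> GH_infimum q X dX Y dY) (at q within {1..})"
    by (rule GH_infimum_tendsto)
  then have "((\<lambda>p. GH_dist p X dX Y dY) \<longlongrightarrow> GH_dist q X dX Y dY) (at q within {1..})"
    unfolding GH_dist_eq
    \<comment> \<open>Both limits are finite, which rules out the product of 0 and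
      \<open>top\<close>, where multiplication is discontinuous.\<close>
    using q \<open>GH_infimum q X dX Y dY < top\<close>
    by (intro tendsto_mult_ennreal tendsto_GH_prefactor) auto
  then show "((\<lambda>p. GH_dist p X dX Y dY) \<longlongrightarrow> GH_dist q X dX Y dY) (at q within {1..p\<^sub>0})"
    by (rule tendsto_within_subset) auto
qed

end
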